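(* (1) $h(n,2K_2)=n$ for every $n\ge 7$; moreover $h(4,2K_2)=6$ and $h(5,2K_2)=h(6,2K_2)=7$. (2) For every integer $t\ge 3$ there exists $n_t$ such that for all $n\ge n_t$, $$h(n,tK_2)=\mathrm{ex}(n,tK_2)+t-1=(t-1)(n-t+1)+\binom{t-1}{2}+(t-1).$$
   Context: Let $H$ be a graph. Define $F_{H,1}$ as the set of maps $f:E(H)\to E(H)$ with $f(e)\neq e$ for every $e\in E(H)$, i.e. $|f(e)\cap e|\le 1$. Given such an $f$, a subgraph $G'$ of $H$ is called $f$-free if $f(e)\notin E(G')$ for every $e\in E(G')$. For a graph $G$ and an integer $n$, $h(n,G)$ denotes the maximum number of edges of an $n$-vertex graph $H$ for which some $f\in F_{H,1}$ exists such that $H$ contains no $f$-free copy of $G$. $\mathrm{ex}(n,G)$ is the Turán number, and $tK_2$ denotes a matching with $t$ edges. *)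

theory Defs
  imports Main "HOL-Library.FuncSet"
begin

type_synonym 'a graph = "'a set \<times> 'a set set"

abbreviation verts :: "'a graph \<Rightarrow> 'a set" where "verts \<equiv> fst"
abbreviation edges :: "'a graph \<Rightarrow> 'a set set" where "edges \<equiv> snd"

definition simple_graph :: "'a graph \<Rightarrow> bool" where
  "simple_graph G \<longleftrightarrow> finite (verts G) \<and> (\<forall>e\<in>edges G. e \<subseteq> verts G \<and> card e = 2)"

definition subgraph :: "'a graph \<Rightarrow> 'a graph \<Rightarrow> bool" where
  "subgraph G' H \<longleftrightarrow> simple_graph G' \<and> verts G' \<subseteq> verts H \<and> edges G' \<subseteq> edges H"

definition graph_iso :: "'a graph \<Rightarrow> 'b graph \<Rightarrow> bool" where
  "graph_iso G G' \<longleftrightarrow>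
     (\<exists>\<phi>. bij_betw \<phi> (verts G) (verts G') \<and> edges G' = (\<lambda>e. \<phi> ` e) ` edges G)"

definition copy_of :: "'b graph \<Rightarrow> 'a graph \<Rightarrow> 'a graph \<Rightarrow> bool" where
  "copy_of G G' H \<longleftrightarrow> subgraph G' H \<and> graph_iso G G'"

definition F1 :: "'a graph \<Rightarrow> ('a set \<Rightarrow> 'a set) set" where
  "F1 H = {f \<in> edges H \<rightarrow>\<^sub>E edges H. \<forall>e\<in>edges H. f e \<noteq> e}"

definition f_free :: "('a set \<Rightarrow> 'a set) \<Rightarrow> 'a graph \<Rightarrow> bool" where
  "f_free f G' \<longleftrightarrow> (\<forall>e\<in>edges G'. f e \<notin> edges G')"

text \<open>Graphs with vertices in \<^typ>\<open>nat\<close> represent all finite graphs up to isomorphism.\<close>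

definition n_graphs :: "nat \<Rightarrow> nat graph set" where
  "n_graphs n = {H. simple_graph H \<and> card (verts H) = n}"

text \<open>\<^const>\<open>Max\<close> is unspecified on the empty set. The lemmas below show that
  for matchings with at least one edge the maxima range over finite nonempty sets.\<close>

definition h :: "nat \<Rightarrow> 'b graph \<Rightarrow> nat" where
  "h n G = Max {card (edges H) |H. H \<in> n_graphs n \<and>
     (\<exists>f\<in>F1 H. \<not> (\<exists>G'. copy_of G G' H \<and> f_free f G'))}"

definition ex :: "nat \<Rightarrow> 'b graph \<Rightarrow> nat" where
  "ex n G = Max {card (edges H) |H. H \<in> n_graphs n \<and> \<not> (\<exists>G'. copy_of G G' H)}"

definition matching_graph :: "nat \<Rightarrow> nat graph" where
  "matching_graph t = ({..<2 * t}, {{2 * i, 2 * i + 1} |i. i < t})"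

lemma finite_card_edges: "finite {card (edges H) |H. H \<in> n_graphs n \<and> P H}"
proof (rule finite_subset)
  show "{card (edges H) |H. H \<in> n_graphs n \<and> P H} \<subseteq> {..2 ^ n}"
  proof clarify
    fix V :: "nat set" and E assume "(V, E) \<in> n_graphs n"
    then have V: "finite V" "card V = n" and E: "E \<subseteq> Pow V"
      by (auto simp: n_graphs_def simple_graph_def)
    have "card E \<le> card (Pow V)" using V E by (intro card_mono) auto
    then show "card (edges (V, E)) \<le> 2 ^ n" using V by (simp add: card_Pow)
  qed
qed simp

lemma empty_graph:
  assumes "t \<ge> 1"
  shows "({..<n}, {}) \<in> n_graphs n" "\<not> copy_of (matching_graph t) G' ({..<n}, {})"
    "(\<lambda>_. undefined) \<in> F1 ({..<n}, {})"
proof -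
  have "edges (matching_graph t) \<noteq> {}"
    using assms by (auto simp: matching_graph_def intro!: exI[of _ 0])
  then show "\<not> copy_of (matching_graph t) G' ({..<n}, {})"
    by (auto simp: copy_of_def subgraph_def graph_iso_def)
qed (auto simp: n_graphs_def simple_graph_def F1_def)

lemma h_attained:
  assumes "t \<ge> 1"
  shows "\<exists>H\<in>n_graphs n. card (edges H) = h n (matching_graph t) \<and>
    (\<exists>f\<in>F1 H. \<not> (\<exists>G'. copy_of (matching_graph t) G' H \<and> f_free f G'))"
proof -
  let ?S = "{card (edges H) |H. H \<in> n_graphs n \<and>
     (\<exists>f\<in>F1 H. \<not> (\<exists>G'. copy_of (matching_graph t) G' H \<and> f_free f G'))}"
  have "?S \<noteq> {}" using empty_graph[OF assms, where n = n] by blast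
  then have "Max ?S \<in> ?S" by (intro Max_in finite_card_edges)
  then show ?thesis unfolding h_def by force
qed

lemma ex_attained:
  assumes "t \<ge> 1"
  shows "\<exists>H\<in>n_graphs n. card (edges H) = ex n (matching_graph t) \<and>
    \<not> (\<exists>G'. copy_of (matching_graph t) G' H)"
proof -
  let ?S = "{card (edges H) |H. H \<in> n_graphs n \<and> \<not> (\<exists>G'. copy_of (matching_graph t) G' H)}"
  have "?S \<noteq> {}" using empty_graph[OF assms, where n = n] by blast
  then have "Max ?S \<in> ?S" by (intro Max_in finite_card_edges)
  then show ?thesis unfolding ex_def by force
qed

end

theory Submission
  imports Defs
begin

text \<open>
  Call a matching \<open>M\<close> free if no edge of \<open>M\<close> is mapped into \<open>M\<close>, and let \<open>k = t - 1\<close>.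
  In a set of \<open>3 * t\<close> edges one finds \<open>t\<close> edges none of which is mapped to another, so a graph
  without free \<open>t\<close>-matching has no large matching, and outside the set \<open>A\<close> of vertices of large
  degree it has boundedly many edges. From more than \<open>k\<close> large stars a free transversal can be
  chosen, so \<open>card A \<le> k\<close>, and if \<open>card A < k\<close> there are too few edges. If \<open>card A = k\<close>, an edge
  \<open>r\<close> avoiding \<open>A\<close> cannot be added to a free transversal of the \<open>k\<close> stars, hence nearly all edges
  of one of these stars are mapped to \<open>r\<close>. Different \<open>r\<close> need different stars, so at most \<open>k\<close>
  edges avoid \<open>A\<close>. For the Turan number the same argument applies to a map whose values
  are not edges: then no edge avoids \<open>A\<close>.

  For \<open>t = 2\<close> any two disjoint edges are linked by \<open>f\<close>, so between sets \<open>S\<close> and \<open>R\<close> of edges there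
  are at most \<open>card S + card R\<close> disjoint pairs. This is applied to a star \<open>S\<close> of maximum size and its
  complement \<open>R\<close>, each edge of which is disjoint from all but at most two edges of \<open>S\<close>.
\<close>

section \<open>Free matchings\<close>

text \<open>A copy of a matching graph has no isolated vertices, so its edges determine it and only
  edge sets are tracked. With \<open>f\<close> constantly \<open>{}\<close>, which is no edge, the
  notion is that of an ordinary matching, so both extremal numbers are covered.\<close>

definition free_matching :: "('a set \<Rightarrow> 'a set) \<Rightarrow> 'a set set \<Rightarrow> nat \<Rightarrow> 'a set set \<Rightarrow> bool" where
  "free_matching f E t M \<longleftrightarrow> M \<subseteq> E \<and> card M = t \<and> pairwise disjnt M \<and> (\<forall>e\<in>M. f e \<notin> M)"

lemma matching_of_copy:
  assumes "copy_of (matching_graph t) G' H"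
  shows "edges G' \<subseteq> edges H" "card (edges G') = t" "pairwise disjnt (edges G')"
proof -
  obtain \<phi> where bij: "bij_betw \<phi> {..<2 * t} (verts G')"
    and E: "edges G' = (\<lambda>e. \<phi> ` e) ` {{2 * i, 2 * i + 1} |i. i < t}"
    and sub: "edges G' \<subseteq> edges H"
    using assms by (auto simp: copy_of_def subgraph_def graph_iso_def matching_graph_def)
  have inj: "inj_on \<phi> {..<2 * t}" using bij by (simp add: bij_betw_def)
  let ?g = "\<lambda>i. \<phi> ` {2 * i, 2 * i + 1}"
  have E': "edges G' = ?g ` {..<t}" unfolding E by blast
  have disj: "disjnt (?g i) (?g j)" if "i < t" "j < t" "i \<noteq> j" for i j
  proof -
    have "{2 * i, 2 * i + 1} \<subseteq> {..<2 * t}" "{2 * j, 2 * j + 1} \<subseteq> {..<2 * t}" using that by auto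
    then have "?g i \<inter> ?g j = \<phi> ` ({2 * i, 2 * i + 1} \<inter> {2 * j, 2 * j + 1})"
      using inj by (metis inj_on_image_Int)
    also have "{2 * i, 2 * i + 1} \<inter> {2 * j, 2 * j + 1} = {}" using that by auto
    finally show ?thesis by (simp add: disjnt_def)
  qed
  have "inj_on ?g {..<t}"
  proof (rule inj_onI)
    fix i j assume *: "i \<in> {..<t}" "j \<in> {..<t}" "?g i = ?g j"
    show "i = j"
    proof (rule ccontr)
      assume "i \<noteq> j"
      then have "disjnt (?g i) (?g i)" using disj[of i j] *(1,2) unfolding *(3) by blast
      then show False by (simp add: disjnt_def)
    qed
  qed
  then show "card (edges G') = t" unfolding E' by (simp add: card_image)
  show "pairwise disjnt (edges G')" unfolding E' pairwise_image
    using disj by (auto simp: pairwise_def)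
  show "edges G' \<subseteq> edges H" by (rule sub)
qed

text \<open>Enumerate \<open>M\<close> by \<open>g\<close> and order the endpoints of each edge.
  Sending \<open>2 * i\<close> and \<open>2 * i + 1\<close> to the endpoints of \<open>g i\<close>
  is injective because distinct edges of \<open>M\<close> are disjoint.\<close>

lemma copy_of_matching:
  assumes H: "simple_graph H" and M: "M \<subseteq> edges H" "card M = t" "pairwise disjnt M"
  shows "copy_of (matching_graph t) (\<Union>M, M) H"
proof -
  have fin: "finite (verts H)" and two: "\<And>e. e \<in> edges H \<Longrightarrow> e \<subseteq> verts H \<and> card e = 2"
    using H by (auto simp: simple_graph_def)
  have "edges H \<subseteq> Pow (verts H)" using two by blast
  then have finM: "finite M" using fin M(1) by (meson finite_Pow_iff finite_subset)
  obtain g where g: "bij_betw g {..<t} M"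
    using finM M(2) ex_bij_betw_nat_finite[of M] by (auto simp: atLeast0LessThan)
  have "\<forall>e\<in>M. \<exists>p q. e = {p, q} \<and> p \<noteq> q" using M(1) two by (metis card_2_iff subsetD)
  then obtain p q where pq: "\<And>e. e \<in> M \<Longrightarrow> e = {p e, q e} \<and> p e \<noteq> q e" by metis
  define \<phi> where "\<phi> m = (if even m then p else q) (g (m div 2))" for m
  have gM: "g i \<in> M" if "i < t" for i using g that by (auto simp: bij_betw_def)
  have \<phi>mem: "\<phi> m \<in> g (m div 2)" if "m < 2 * t" for m
    using pq[OF gM[of "m div 2"]] that by (auto simp: \<phi>_def less_mult_imp_div_less mult.commute)
  have inj: "inj_on \<phi> {..<2 * t}"
  proof (rule inj_onI)
    fix a b assume ab: "a \<in> {..<2 * t}" "b \<in> {..<2 * t}" "\<phi> a = \<phi> b"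
    have lt: "a div 2 < t" "b div 2 < t" using ab by auto
    have "\<not> disjnt (g (a div 2)) (g (b div 2))"
      using \<phi>mem[of a] \<phi>mem[of b] ab by (auto simp: disjnt_def)
    then have "g (a div 2) = g (b div 2)"
      using M(3) gM[OF lt(1)] gM[OF lt(2)] by (auto simp: pairwise_def)
    then have eq: "a div 2 = b div 2" using g lt by (auto simp: bij_betw_def dest: inj_onD)
    have "even a \<longleftrightarrow> even b"
      using ab(3) pq[OF gM[OF lt(1)]] eq by (auto simp: \<phi>_def split: if_splits)
    with eq show "a = b" by presburger
  qed
  have img: "\<phi> ` {2 * i, 2 * i + 1} = g i" if "i < t" for i
    using pq[OF gM[OF that]] by (auto simp: \<phi>_def)
  have "(\<lambda>e. \<phi> ` e) ` {{2 * i, 2 * i + 1} |i. i < t} = (\<lambda>i. \<phi> ` {2 * i, 2 * i + 1}) ` {..<t}" by blast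
  also have "\<dots> = g ` {..<t}" using img by (intro image_cong) auto
  also have "\<dots> = M" using g by (auto simp: bij_betw_def)
  finally have E: "(\<lambda>e. \<phi> ` e) ` {{2 * i, 2 * i + 1} |i. i < t} = M" .
  have "\<phi> ` {..<2 * t} = \<Union> ((\<lambda>e. \<phi> ` e) ` {{2 * i, 2 * i + 1} |i. i < t})"
  proof -
    have "{..<2 * t} = \<Union> {{2 * i, 2 * i + 1} |i. i < t}"
    proof (intro equalityI subsetI)
      fix m assume "m \<in> {..<2 * t}"
      then show "m \<in> \<Union> {{2 * i, 2 * i + 1} |i. i < t}"
        by (intro UnionI[of "{2 * (m div 2), 2 * (m div 2) + 1}"])
           (auto intro!: exI[of _ "m div 2"])
    qed auto
    then show ?thesis by blast
  qed
  then have bij: "bij_betw \<phi> {..<2 * t} (\<Union>M)" using inj E by (simp add: bij_betw_def)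
  have "graph_iso (matching_graph t) (\<Union>M, M)"
    unfolding graph_iso_def matching_graph_def fst_conv snd_conv
    by (intro exI[of _ \<phi>] conjI bij E[symmetric])
  moreover have "subgraph (\<Union>M, M) H"
    unfolding subgraph_def simple_graph_def fst_conv snd_conv
  proof (intro conjI ballI)
    show "\<Union>M \<subseteq> verts H" using M(1) two by blast
    then show "finite (\<Union>M)" using fin by (rule finite_subset)
    show "card e = 2" if "e \<in> M" for e using that M(1) two by blast
  qed (use M(1) in auto)
  ultimately show ?thesis by (simp add: copy_of_def)
qed

lemma free_copy_iff:
  assumes "simple_graph H"
  shows "(\<exists>G'. copy_of (matching_graph t) G' H \<and> f_free f G')
    \<longleftrightarrow> (\<exists>M. free_matching f (edges H) t M)"
proof
  assume "\<exists>G'. copy_of (matching_graph t) G' H \<and> f_free f G'"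
  then obtain G' where G': "copy_of (matching_graph t) G' H" "f_free f G'" by (elim exE conjE)
  have "free_matching f (edges H) t (edges G')"
    unfolding free_matching_def using matching_of_copy[OF G'(1)] G'(2) by (simp add: f_free_def)
  then show "\<exists>M. free_matching f (edges H) t M" ..
next
  assume "\<exists>M. free_matching f (edges H) t M"
  then obtain M where M: "M \<subseteq> edges H" "card M = t" "pairwise disjnt M" "\<forall>e\<in>M. f e \<notin> M"
    unfolding free_matching_def by blast
  moreover have "f_free f (\<Union>M, M)" using M(4) by (simp add: f_free_def)
  ultimately show "\<exists>G'. copy_of (matching_graph t) G' H \<and> f_free f G'"
    using copy_of_matching[OF assms] by blast
qed

text \<open>The empty set is not an edge, so the constant map to it makes every matching free.\<close>

lemma copy_iff:
  assumes "simple_graph H"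
  shows "(\<exists>G'. copy_of (matching_graph t) G' H)
    \<longleftrightarrow> (\<exists>M. free_matching (\<lambda>_. {}) (edges H) t M)"
proof -
  have "f_free (\<lambda>_. {}) G'" if "copy_of (matching_graph t) G' H" for G'
    using that assms by (auto simp: copy_of_def subgraph_def simple_graph_def f_free_def)
  then show ?thesis unfolding free_copy_iff[OF assms, symmetric] by blast
qed

section \<open>Extremal values\<close>

definition pairs :: "'a set \<Rightarrow> 'a set set" where
  "pairs V = {e. e \<subseteq> V \<and> card e = 2}"

lemma finite_pairs: "finite V \<Longrightarrow> finite (pairs V)"
  by (simp add: pairs_def)

lemma card_pairs: "finite V \<Longrightarrow> card (pairs V) = card V choose 2"
  by (simp add: pairs_def n_subsets)

lemma pairs_with:
  assumes "e \<in> pairs V" "x \<in> e"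
  obtains y where "e = {x, y}" "x \<noteq> y" "y \<in> V"
  using assms by (auto simp: pairs_def card_2_iff)

lemma n_graphs_iff:
  "(V, E) \<in> n_graphs n \<longleftrightarrow> finite V \<and> card V = n \<and> E \<subseteq> pairs V"
  by (auto simp: n_graphs_def simple_graph_def pairs_def)

text \<open>Reduces a value of \<open>h\<close> to statements about edge sets: one construction with
  exactly \<open>m\<close> edges, and an upper bound for every edge set on \<open>n\<close>
  vertices.\<close>

lemma h_matching_eqI:
  assumes lower: "finite (V :: nat set)" "card V = n" "E \<subseteq> pairs V" "card E = m"
      "\<And>e. e \<in> E \<Longrightarrow> f e \<in> E \<and> f e \<noteq> e" "\<And>M. \<not> free_matching f E t M"
    and upper: "\<And>V E f. \<lbrakk>finite (V :: nat set); card V = n; E \<subseteq> pairs V;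
      \<And>e. e \<in> E \<Longrightarrow> f e \<in> E \<and> f e \<noteq> e; \<And>M. \<not> free_matching f E t M\<rbrakk> \<Longrightarrow> card E \<le> m"
  shows "h n (matching_graph t) = m"
  unfolding h_def
proof (rule Max_eqI[OF finite_card_edges])
  fix c
  assume "c \<in> {card (edges H) |H. H \<in> n_graphs n \<and>
     (\<exists>f\<in>F1 H. \<not> (\<exists>G'. copy_of (matching_graph t) G' H \<and> f_free f G'))}"
  then obtain V E f where *: "c = card E" "(V, E) \<in> n_graphs n" "f \<in> F1 (V, E)"
    "\<not> (\<exists>G'. copy_of (matching_graph t) G' (V, E) \<and> f_free f G')" by auto
  have "simple_graph (V, E)" using *(2) by (simp add: n_graphs_def)
  then have nf: "\<not> free_matching f E t M" for M using free_copy_iff[of "(V, E)" t f] *(4) by simp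
  show "c \<le> m" unfolding *(1)
  proof (rule upper)
    show "finite V" "card V = n" "E \<subseteq> pairs V" using *(2) by (simp_all add: n_graphs_iff)
    show "f e \<in> E \<and> f e \<noteq> e" if "e \<in> E" for e using that *(3) by (auto simp: F1_def)
    show "\<not> free_matching f E t M" for M by (rule nf)
  qed
next
  \<comment> \<open>Members of \<open>F1\<close> are extensional, so \<open>f\<close> is restricted
    to \<open>E\<close>; freeness of a matching inside \<open>E\<close> depends only on values on
    \<open>E\<close>.\<close>
  let ?f = "restrict f E"
  have fm: "free_matching ?f E t M \<longleftrightarrow> free_matching f E t M" for M
    by (auto simp: free_matching_def)
  have H: "(V, E) \<in> n_graphs n" using lower by (simp add: n_graphs_iff)
  then have "simple_graph (V, E)" by (simp add: n_graphs_def)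
  then have "\<not> (\<exists>G'. copy_of (matching_graph t) G' (V, E) \<and> f_free ?f G')"
    using free_copy_iff[of "(V, E)" t ?f] fm lower(6) by simp
  moreover have "?f \<in> F1 (V, E)" using lower(5) by (auto simp: F1_def)
  ultimately show "m \<in> {card (edges H) |H. H \<in> n_graphs n \<and>
     (\<exists>f\<in>F1 H. \<not> (\<exists>G'. copy_of (matching_graph t) G' H \<and> f_free f G'))}"
    using H lower(4) by force
qed

lemma ex_matching_eqI:
  assumes lower: "finite (V :: nat set)" "card V = n" "E \<subseteq> pairs V" "card E = m"
      "\<And>M. \<not> free_matching (\<lambda>_. {}) E t M"
    and upper: "\<And>V E. \<lbrakk>finite (V :: nat set); card V = n; E \<subseteq> pairs V;
      \<And>M. \<not> free_matching (\<lambda>_. {}) E t M\<rbrakk> \<Longrightarrow> card E \<le> m"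
  shows "ex n (matching_graph t) = m"
  unfolding ex_def
proof (rule Max_eqI[OF finite_card_edges])
  fix c
  assume "c \<in> {card (edges H) |H. H \<in> n_graphs n \<and> \<not> (\<exists>G'. copy_of (matching_graph t) G' H)}"
  then obtain V E where *: "c = card E" "(V, E) \<in> n_graphs n"
    "\<not> (\<exists>G'. copy_of (matching_graph t) G' (V, E))" by auto
  have "simple_graph (V, E)" using *(2) by (simp add: n_graphs_def)
  then have nf: "\<not> free_matching (\<lambda>_. {}) E t M" for M using copy_iff[of "(V, E)" t] *(3) by simp
  show "c \<le> m" unfolding *(1)
  proof (rule upper)
    show "finite V" "card V = n" "E \<subseteq> pairs V" using *(2) by (simp_all add: n_graphs_iff)
    show "\<not> free_matching (\<lambda>_. {}) E t M" for M by (rule nf)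
  qed
next
  have H: "(V, E) \<in> n_graphs n" using lower by (simp add: n_graphs_iff)
  then have "simple_graph (V, E)" by (simp add: n_graphs_def)
  then have "\<not> (\<exists>G'. copy_of (matching_graph t) G' (V, E))"
    using copy_iff[of "(V, E)" t] lower(5) by simp
  then show "m \<in> {card (edges H) |H. H \<in> n_graphs n \<and> \<not> (\<exists>G'. copy_of (matching_graph t) G' H)}"
    using H lower(4) by force
qed

text \<open>The pairs missing \<open>A\<close> are the pairs among the other \<open>n - k\<close>
  vertices, so the count is a difference of two binomial coefficients. It is the claimed Turan
  number for matchings with \<open>k + 1\<close> edges.\<close>

lemma card_pairs_meeting:
  assumes "finite V" "A \<subseteq> V" "card A = k" "card V = n"
  shows "card {e \<in> pairs V. e \<inter> A \<noteq> {}} = (k choose 2) + k * (n - k)"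
proof -
  obtain j where j: "n = k + j" using assms by (metis card_mono le_Suc_ex)
  have "card (V - A) = j" using assms j by (simp add: card_Diff_subset finite_subset)
  moreover have "{e \<in> pairs V. e \<inter> A \<noteq> {}} = pairs V - pairs (V - A)"
    by (auto simp: pairs_def)
  moreover have "pairs (V - A) \<subseteq> pairs V" by (auto simp: pairs_def)
  ultimately have "card {e \<in> pairs V. e \<inter> A \<noteq> {}} = (k + j choose 2) - (j choose 2)"
    using assms j by (simp add: card_Diff_subset finite_pairs card_pairs)
  moreover have "(k + j choose 2) = (k choose 2) + k * j + (j choose 2)"
    by (induction j) (auto simp: numeral_2_eq_2)
  ultimately show ?thesis using j by simp
qed

section \<open>Free transversals of large stars\<close>

lemma card_Diff_ge:
  assumes "finite X" "card X \<le> c"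
  shows "card A - c \<le> card (A - X)"
  using diff_card_le_card_Diff[OF assms(1), of A] assms(2) by linarith

text \<open>Averaging: the fibres of \<open>f\<close> over \<open>S\<close> are disjoint subsets of
  \<open>U\<close>, so they cannot all have more than \<open>c\<close> elements.\<close>

lemma few_preimages:
  assumes "finite S" "finite U" "S \<noteq> {}" "card U \<le> c * card S"
  shows "\<exists>e\<in>S. card {d \<in> U. f d = e} \<le> c"
proof (rule ccontr)
  assume "\<not> ?thesis"
  then have "Suc c \<le> card {d \<in> U. f d = e}" if "e \<in> S" for e using that by (simp add: not_le Suc_le_eq)
  then have "Suc c * card S \<le> (\<Sum>e\<in>S. card {d \<in> U. f d = e})"
    using sum_bounded_below[of S "Suc c" "\<lambda>e. card {d \<in> U. f d = e}"] by (simp add: mult.commute)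
  also have "\<dots> = card (\<Union>e\<in>S. {d \<in> U. f d = e})"
    using assms by (intro card_UN_disjoint[symmetric]) auto
  also have "\<dots> \<le> card U" using assms by (intro card_mono) auto
  finally have "Suc c * card S \<le> c * card S" using assms(4) by (rule order_trans)
  then show False using assms by simp
qed

text \<open>Greedy choice: some \<open>e\<close> has at most one preimage in \<open>M\<close>.
  Taking \<open>e\<close> and discarding \<open>e\<close>, \<open>f e\<close> and that preimage
  costs at most three elements per step.\<close>

lemma free_subset:
  assumes "finite M" "\<And>e. e \<in> M \<Longrightarrow> f e \<noteq> e" "3 * t \<le> card M"
  shows "\<exists>N\<subseteq>M. card N = t \<and> (\<forall>e\<in>N. f e \<notin> N)"
  using assms
proof (induction t arbitrary: M)
  case 0
  then show ?case by (intro exI[of _ "{}"]) auto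
next
  case (Suc t)
  then obtain e where e: "e \<in> M" "card {d \<in> M. f d = e} \<le> 1"
    using few_preimages[of M M 1 f] by fastforce
  let ?X = "{e, f e} \<union> {d \<in> M. f d = e}"
  have "card ?X \<le> card {e, f e} + card {d \<in> M. f d = e}" by (rule card_Un_le)
  also have "\<dots> \<le> 2 + 1" using e by (intro add_mono) (auto simp: card_insert_if)
  finally have "card M - 3 \<le> card (M - ?X)"
    using Suc.prems(1) by (intro card_Diff_ge) auto
  then have "3 * t \<le> card (M - ?X)" using Suc.prems(3) by simp
  then obtain N where N: "N \<subseteq> M - ?X" "card N = t" "\<forall>d\<in>N. f d \<notin> N"
    using Suc.IH[of "M - ?X"] Suc.prems by auto
  have "finite N" "e \<notin> N" using N Suc.prems(1) by (auto intro: finite_subset)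
  then show ?case using N e Suc.prems(2)
    by (intro exI[of _ "insert e N"]) auto
qed

lemma edge_with:
  assumes "card e = 2" "a \<in> e"
  obtains x where "e = {a, x}" "x \<noteq> a"
  using assms by (auto simp: card_2_iff)

text \<open>Induction on \<open>A\<close>: pick an edge \<open>e\<close> at the new centre with at
  most \<open>card B\<close> preimages among the other stars, and delete from those stars whatever
  conflicts with \<open>e\<close>. With \<open>k = card B\<close> each loses at most
  \<open>k + 2\<close> edges, which fits into the gap \<open>2 * k + 3\<close> between consecutive
  squares.\<close>

lemma free_star_transversal:
  assumes "finite A"
    and "\<And>a. a \<in> A \<Longrightarrow> finite (S a) \<and> (card A + 1)\<^sup>2 \<le> card (S a)"
    and "\<And>a e. a \<in> A \<Longrightarrow> e \<in> S a \<Longrightarrow> card e = 2 \<and> e \<inter> A = {a} \<and> f e \<noteq> e"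
  shows "\<exists>M\<subseteq>\<Union>(S ` A). card M = card A \<and> finite M \<and> pairwise disjnt M \<and> (\<forall>e\<in>M. f e \<notin> M)"
  using assms
proof (induction A arbitrary: S rule: finite_induct)
  case empty
  then show ?case by (intro exI[of _ "{}"]) auto
next
  case (insert a B)
  let ?k = "card B" and ?s = "(card B + 2)\<^sup>2"
  have S: "finite (S b)" "?s \<le> card (S b)" if "b \<in> insert a B" for b
    using insert.prems(1)[OF that] insert.hyps by auto
  \<comment> \<open>The other stars are cut down to equal size, so that some \<open>e\<close> in \<open>S a\<close> has few preimages.\<close>
  have "\<exists>T\<subseteq>S b. card T = ?s" if "b \<in> B" for b
    using S[of b] that by (meson insertI2 obtain_subset_with_card_n)
  then obtain T where T: "\<And>b. b \<in> B \<Longrightarrow> T b \<subseteq> S b \<and> card (T b) = ?s" by metis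
  have finT: "finite (T b)" if "b \<in> B" for b
    using T[OF that] S(1)[of b] that by (auto intro: finite_subset)
  let ?U = "\<Union>(T ` B)"
  have "card ?U \<le> (\<Sum>b\<in>B. card (T b))" using insert.hyps(1) by (rule card_UN_le)
  also have "\<dots> = ?k * ?s" using T by simp
  also have "\<dots> \<le> ?k * card (S a)" using S(2)[of a] by simp
  finally have "card ?U \<le> ?k * card (S a)" .
  moreover have "S a \<noteq> {}" using S(2)[of a] by auto
  moreover have finU: "finite ?U" using insert.hyps(1) finT by auto
  ultimately obtain e where e: "e \<in> S a" "card {d \<in> ?U. f d = e} \<le> ?k"
    using few_preimages[of "S a" ?U ?k f] S(1)[of a] by blast
  have ea: "card e = 2" "e \<inter> insert a B = {a}" using insert.prems(2)[of a e] e(1) by auto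
  then have "a \<in> e" by blast
  with ea(1) obtain x where "e = {a, x}" "x \<noteq> a" by (rule edge_with)
  with ea(2) have x: "e = {a, x}" "x \<noteq> a" "x \<notin> B" by auto
  \<comment> \<open>An edge at \<open>b\<close> avoids \<open>a\<close>, so it meets
    \<open>e\<close> only if it is \<open>{b, x}\<close>. Removing \<open>f e\<close> and the
    preimages of \<open>e\<close> keeps freeness when \<open>e\<close> is added.\<close>
  define S' where "S' b = T b - ({{b, x}} \<union> {f e} \<union> {d \<in> ?U. f d = e})" for b
  have big: "finite (S' b) \<and> (?k + 1)\<^sup>2 \<le> card (S' b)" if b: "b \<in> B" for b
  proof -
    let ?X = "{{b, x}} \<union> {f e} \<union> {d \<in> ?U. f d = e}"
    have "card ?X \<le> card {{b, x}} + card {f e} + card {d \<in> ?U. f d = e}"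
      by (meson add_mono card_Un_le le_refl order_trans)
    also have "\<dots> \<le> ?k + 2" using e(2) by simp
    finally have "card ?X \<le> ?k + 2" .
    moreover have "finite {d \<in> ?U. f d = e}" using finU by (rule rev_finite_subset) blast
    then have "finite ?X" by (intro finite_UnI) (rule finite.intros | assumption)+
    ultimately have "card (T b) - (?k + 2) \<le> card (S' b)"
      unfolding S'_def by (intro card_Diff_ge)
    moreover have "(?k + 1)\<^sup>2 + (?k + 2) \<le> ?s" by (simp add: power2_eq_square algebra_simps)
    ultimately show ?thesis using T[OF b] finT[OF b] by (simp add: S'_def)
  qed
  have S': "d \<in> S b" "d \<in> T b" "d \<noteq> f e" "f d \<noteq> e" "d \<inter> insert a B = {b}" "d \<noteq> {b, x}"
      "card d = 2" "f d \<noteq> d"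
    if "b \<in> B" "d \<in> S' b" for b d
    using that T[OF that(1)] insert.prems(2)[of b d] unfolding S'_def by auto
  have "\<exists>M\<subseteq>\<Union>(S' ` B). card M = ?k \<and> finite M \<and> pairwise disjnt M \<and> (\<forall>e\<in>M. f e \<notin> M)"
  proof (rule insert.IH)
    fix b d assume bd: "b \<in> B" "d \<in> S' b"
    have "d \<inter> B = {b}" using S'(5)[OF bd] insert.hyps(2) bd(1) by blast
    then show "card d = 2 \<and> d \<inter> B = {b} \<and> f d \<noteq> d" using S'(7,8)[OF bd] by simp
  qed (rule big)
  then obtain M where M: "M \<subseteq> \<Union>(S' ` B)" "card M = ?k" "finite M" "pairwise disjnt M"
    "\<forall>e\<in>M. f e \<notin> M" by blast
  have disj: "disjnt e d" "d \<noteq> f e" "f d \<noteq> e" if d: "d \<in> M" for d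
  proof -
    obtain b where b: "b \<in> B" "d \<in> S' b" using M(1) d by blast
    note d = S'[OF b]
    show "d \<noteq> f e" "f d \<noteq> e" using d by auto
    have "a \<noteq> b" using b insert.hyps by auto
    then have "a \<notin> d" using d(5) by auto
    moreover have "x \<notin> d"
    proof
      assume "x \<in> d"
      moreover have "b \<in> d" "b \<noteq> x" using d(5) x(3) b(1) by auto
      ultimately have "d = {b, x}" using d(7) by (auto simp: card_2_iff)
      with d(6) show False ..
    qed
    ultimately show "disjnt e d" by (simp add: x(1) disjnt_def)
  qed
  have "e \<notin> M" using disj(1)[of e] x by (auto simp: disjnt_def)
  have "f e \<noteq> e" using insert.prems(2)[of a e] e(1) by auto
  show ?case
  proof (intro exI[of _ "insert e M"] conjI)
    show "insert e M \<subseteq> \<Union>(S ` insert a B)" using e(1) M(1) S'(1) by blast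
    show "card (insert e M) = card (insert a B)"
      using M \<open>e \<notin> M\<close> insert.hyps by simp
    show "pairwise disjnt (insert e M)"
      using M(4) disj(1) by (auto simp: pairwise_insert disjnt_sym)
    show "\<forall>d\<in>insert e M. f d \<notin> insert e M"
      using M(5) disj(2,3) \<open>f e \<noteq> e\<close> by fastforce
  qed (use M in auto)
qed

section \<open>Vertices of large degree and edges of bounded degree\<close>

definition star :: "'a set set \<Rightarrow> 'a \<Rightarrow> 'a set set" where
  "star E v = {e \<in> E. v \<in> e}"

lemma finite_star [simp]: "finite E \<Longrightarrow> finite (star E v)"
  by (simp add: star_def)

text \<open>Each \<open>b\<close> in \<open>B\<close> accounts for at most one edge at
  \<open>a\<close>, namely \<open>{a, b}\<close>.\<close>

lemma card_star_meeting:
  assumes E: "\<And>e. e \<in> E \<Longrightarrow> card e = 2" and B: "finite B" "a \<notin> B"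
  shows "card {e \<in> star E a. e \<inter> B \<noteq> {}} \<le> card B"
proof -
  have "{e \<in> star E a. e \<inter> B \<noteq> {}} \<subseteq> (\<lambda>b. {a, b}) ` B"
  proof
    fix e assume "e \<in> {e \<in> star E a. e \<inter> B \<noteq> {}}"
    then obtain b where "a \<in> e" "b \<in> e" "b \<in> B" "e \<in> E" by (auto simp: star_def)
    moreover then have "e = {a, b}" using E B(2) by (fastforce simp: card_2_iff)
    ultimately show "e \<in> (\<lambda>b. {a, b}) ` B" by blast
  qed
  then show ?thesis using B(1) by (rule surj_card_le[rotated])
qed

text \<open>Otherwise each star keeps at least \<open>(k + 2)\<^sup>2\<close> edges after losing the
  at most \<open>k\<close> edges to other vertices of \<open>A\<close>, and a free transversal of
  these \<open>k + 1\<close> stars is a forbidden free matching.\<close>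

lemma few_big_stars:
  assumes E: "finite E" "\<And>e. e \<in> E \<Longrightarrow> card e = 2 \<and> f e \<noteq> e"
    and free: "\<And>M. \<not> free_matching f E (Suc k) M"
    and A: "card A = Suc k"
  shows "\<exists>a\<in>A. card (star E a) < (k + 2)\<^sup>2 + k"
proof (rule ccontr)
  assume "\<not> ?thesis"
  then have big: "(k + 2)\<^sup>2 + k \<le> card (star E a)" if "a \<in> A" for a using that by force
  have finA: "finite A" using A by (metis card.infinite nat.distinct(1))
  define S where "S a = star E a - {e \<in> star E a. e \<inter> (A - {a}) \<noteq> {}}" for a
  have "(card A + 1)\<^sup>2 \<le> card (S a)" if "a \<in> A" for a
  proof -
    have "card {e \<in> star E a. e \<inter> (A - {a}) \<noteq> {}} \<le> k"
      using card_star_meeting[of E "A - {a}" a] E A finA that by simp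
    then have "card (star E a) - k \<le> card (S a)"
      unfolding S_def using E(1) by (intro card_Diff_ge) (auto simp: star_def)
    then show ?thesis using big[OF that] A by simp
  qed
  moreover have "finite (S a)" for a using E(1) by (simp add: S_def star_def)
  moreover have "card e = 2 \<and> e \<inter> A = {a} \<and> f e \<noteq> e" if "a \<in> A" "e \<in> S a" for a e
    using that E(2)[of e] by (auto simp: S_def star_def)
  ultimately have "\<exists>M\<subseteq>\<Union>(S ` A). card M = card A \<and> finite M \<and> pairwise disjnt M \<and> (\<forall>e\<in>M. f e \<notin> M)"
    by (intro free_star_transversal[OF finA]) simp_all
  then obtain M where "M \<subseteq> \<Union>(S ` A)" "card M = card A" "pairwise disjnt M" "\<forall>e\<in>M. f e \<notin> M"
    by blast
  moreover then have "M \<subseteq> E" by (auto simp: S_def star_def)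
  ultimately show False using free[of M] A by (simp add: free_matching_def)
qed

text \<open>Otherwise the \<open>k\<close> stars have a free transversal that is disjoint from
  \<open>r\<close>, omits \<open>f r\<close> and has no edge mapped to \<open>r\<close>; adding
  \<open>r\<close> yields a free matching with \<open>k + 1\<close> edges.\<close>

lemma outer_edge_attracts_star:
  assumes E: "finite E" "\<And>e. e \<in> E \<Longrightarrow> card e = 2 \<and> f e \<noteq> e"
    and free: "\<And>M. \<not> free_matching f E (Suc k) M"
    and A: "finite A" "card A = k" and r: "r \<in> E" "r \<inter> A = {}"
  shows "\<exists>a\<in>A. card {e \<in> star E a. f e \<noteq> r} < (k + 1)\<^sup>2 + k + 3"
proof (rule ccontr)
  assume "\<not> ?thesis"
  then have big: "(k + 1)\<^sup>2 + k + 3 \<le> card {e \<in> star E a. f e \<noteq> r}" if "a \<in> A" for a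
    using that by force
  have r2: "finite r" "card r = 2" using E(2)[OF r(1)] by (auto intro: card_ge_0_finite)
  \<comment> \<open>Obstructions to adding \<open>r\<close> or to being a private edge of
    \<open>a\<close>: the edge \<open>f r\<close>, and at most \<open>k + 2\<close> edges at
    \<open>a\<close> meeting \<open>r\<close> or the rest of \<open>A\<close>.\<close>
  define X where "X a = insert (f r) {e \<in> star E a. e \<inter> ((A - {a}) \<union> r) \<noteq> {}}" for a
  define S where "S a = {e \<in> star E a. f e \<noteq> r} - X a" for a
  have "(card A + 1)\<^sup>2 \<le> card (S a)" if "a \<in> A" for a
  proof -
    have "card {e \<in> star E a. e \<inter> ((A - {a}) \<union> r) \<noteq> {}} \<le> card ((A - {a}) \<union> r)"
      using E A r r2 that by (intro card_star_meeting) auto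
    also have "\<dots> \<le> card (A - {a}) + card r" by (rule card_Un_le)
    also have "\<dots> \<le> k + 2" using A(2) r2 card_Diff1_le[of A a] by simp
    finally have "card (X a) \<le> k + 3" using E(1) by (simp add: X_def star_def card_insert_if)
    then have "card {e \<in> star E a. f e \<noteq> r} - (k + 3) \<le> card (S a)"
      unfolding S_def using E(1) by (intro card_Diff_ge) (auto simp: star_def X_def)
    then show ?thesis using big[OF that] A by simp
  qed
  moreover have "finite (S a)" for a using E(1) by (simp add: S_def star_def)
  moreover have "card e = 2 \<and> e \<inter> A = {a} \<and> f e \<noteq> e" if "a \<in> A" "e \<in> S a" for a e
    using that E(2)[of e] by (auto simp: S_def star_def X_def)
  ultimately have "\<exists>M\<subseteq>\<Union>(S ` A). card M = card A \<and> finite M \<and> pairwise disjnt M \<and> (\<forall>e\<in>M. f e \<notin> M)"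
    by (intro free_star_transversal[OF A(1)]) simp_all
  then obtain M where M: "M \<subseteq> \<Union>(S ` A)" "card M = card A" "finite M" "pairwise disjnt M"
      "\<forall>e\<in>M. f e \<notin> M" by blast
  have MS: "d \<in> E \<and> disjnt r d \<and> f d \<noteq> r \<and> d \<noteq> f r" if "d \<in> M" for d
    using M(1) that by (auto simp: S_def X_def star_def disjnt_def)
  have "r \<notin> M" using MS[of r] r2 by (auto simp: disjnt_def)
  have "free_matching f E (Suc k) (insert r M)"
    unfolding free_matching_def
  proof (intro conjI)
    show "insert r M \<subseteq> E" using MS r by blast
    show "card (insert r M) = Suc k" using M \<open>r \<notin> M\<close> A by simp
    show "pairwise disjnt (insert r M)" using M(4) MS by (auto simp: pairwise_insert disjnt_sym)
    show "\<forall>d\<in>insert r M. f d \<notin> insert r M" using M(5) MS E(2)[OF r(1)] by fastforce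
  qed
  with free show False by blast
qed

text \<open>By \<open>free_subset\<close> a matching of maximum size has at most
  \<open>3 * t\<close> edges. Its at most \<open>6 * t\<close> vertices meet every edge of
  \<open>R\<close>, and each lies on at most \<open>L\<close> edges.\<close>

lemma card_bounded_degree:
  assumes R: "finite R" "\<And>e. e \<in> R \<Longrightarrow> card e = 2 \<and> f e \<noteq> e"
    and deg: "\<And>v. card (star R v) \<le> L"
    and free: "\<And>M. \<not> free_matching f R t M"
  shows "card R \<le> 6 * t * L"
proof -
  let ?P = "\<lambda>M. M \<subseteq> R \<and> pairwise disjnt M"
  have "finite {M. ?P M}" using R(1) by simp
  moreover have "{} \<in> {M. ?P M}" by simp
  ultimately have fin: "finite (card ` {M. ?P M})" and "card ` {M. ?P M} \<noteq> {}" by auto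
  then have "Max (card ` {M. ?P M}) \<in> card ` {M. ?P M}" by (rule Max_in)
  then obtain M where M: "?P M" and "card M = Max (card ` {M. ?P M})" by auto
  then have max: "card N \<le> card M" if "?P N" for N using that Max_ge[OF fin] by simp
  have finM: "finite M" using M R(1) by (auto intro: finite_subset)
  have "\<not> 3 * t \<le> card M"
  proof
    assume "3 * t \<le> card M"
    moreover have "f e \<noteq> e" if "e \<in> M" for e using M R(2) that by blast
    ultimately obtain N where "N \<subseteq> M" "card N = t" "\<forall>e\<in>N. f e \<notin> N"
      using free_subset[OF finM, of f t] by blast
    moreover then have "N \<subseteq> R" "pairwise disjnt N" using M pairwise_subset by blast+
    ultimately show False using free[of N] by (simp add: free_matching_def)
  qed
  then have M3: "card M \<le> 3 * t" by simp
  have fin2: "card e = 2" "finite e" if "e \<in> M" for e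
  proof -
    show "card e = 2" using M R(2)[of e] that by blast
    then show "finite e" by (simp add: card_ge_0_finite)
  qed
  have "card (\<Union>M) \<le> (\<Sum>e\<in>M. card e)" by (rule card_Union_le_sum_card)
  also have "\<dots> = 2 * card M" using fin2 by simp
  finally have UM: "card (\<Union>M) \<le> 6 * t" using M3 by simp
  have finUM: "finite (\<Union>M)" using finM fin2 by blast
  have "R \<subseteq> (\<Union>v\<in>\<Union>M. star R v)"
  proof
    fix e assume e: "e \<in> R"
    have "\<not> (\<forall>d\<in>M. disjnt e d)"
    proof
      assume *: "\<forall>d\<in>M. disjnt e d"
      then have "?P (insert e M)" using M e by (auto simp: pairwise_insert disjnt_sym)
      moreover have "e \<notin> M" using * R(2)[OF e] by (auto simp: disjnt_def)
      ultimately show False using max[of "insert e M"] finM by simp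
    qed
    then obtain v where "v \<in> e" "v \<in> \<Union>M" by (auto simp: disjnt_def)
    then show "e \<in> (\<Union>v\<in>\<Union>M. star R v)" using e by (auto simp: star_def)
  qed
  then have "card R \<le> card (\<Union>v\<in>\<Union>M. star R v)"
    using finUM R(1) by (intro card_mono finite_UN_I) auto
  also have "\<dots> \<le> (\<Sum>v\<in>\<Union>M. card (star R v))" using finUM by (rule card_UN_le)
  also have "\<dots> \<le> card (\<Union>M) * L" using deg sum_bounded_above[of "\<Union>M" "\<lambda>v. card (star R v)" L] by simp
  also have "\<dots> \<le> 6 * t * L" using UM by simp
  finally show ?thesis .
qed

section \<open>Graphs of large order\<close>

text \<open>The number of exceptions in \<open>outer_edge_attracts_star\<close>. Twice this number
  is the threshold for large degree, so that no star can be attracted by two different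
  edges.\<close>

definition attract_bound :: "nat \<Rightarrow> nat" where
  "attract_bound k = (k + 1)\<^sup>2 + k + 3"

text \<open>For such \<open>n\<close>, fewer than \<open>k\<close> large stars together with the
  bounded remainder, at most \<open>(k - 1) * n + 12 * (k + 1) * attract_bound k\<close> edges,
  cannot exceed \<open>k * (n - k)\<close>.\<close>

definition order_bound :: "nat \<Rightarrow> nat" where
  "order_bound k = k\<^sup>2 + 12 * (k + 1) * attract_bound k"

text \<open>\<open>A\<close> is the set of vertices of large degree. More than \<open>k\<close> of
  them contradict \<open>few_big_stars\<close>; with fewer than \<open>k\<close>, the edges avoiding
  \<open>A\<close> are bounded by \<open>card_bounded_degree\<close> and the total is too small.
  Both upper bounds below start from this structure.\<close>

lemma dense_core:
  assumes V: "finite V" "card V = n" and E: "E \<subseteq> pairs V" "\<And>e. e \<in> E \<Longrightarrow> f e \<noteq> e"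
    and free: "\<And>M. \<not> free_matching f E (Suc k) M"
    and k: "k \<ge> 1" and n: "n \<ge> order_bound k" and dense: "(k choose 2) + k * (n - k) < card E"
  obtains A where "A \<subseteq> V" "card A = k"
    "\<And>a. a \<in> A \<Longrightarrow> 2 * attract_bound k \<le> card (star E a)"
    "\<And>r. r \<in> E \<Longrightarrow> r \<inter> A = {} \<Longrightarrow> \<exists>a\<in>A. card {e \<in> star E a. f e \<noteq> r} < attract_bound k"
proof -
  let ?L = "2 * attract_bound k"
  have finE: "finite E" using E(1) V(1) finite_pairs by (blast intro: finite_subset)
  have E2: "card e = 2 \<and> f e \<noteq> e" if "e \<in> E" for e using E that by (auto simp: pairs_def)
  define A where "A = {v \<in> V. ?L \<le> card (star E v)}"
  define R where "R = {e \<in> E. e \<inter> A = {}}"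
  have finA: "finite A" using V by (simp add: A_def)
  have "card A \<le> k"
  proof (rule ccontr)
    assume "\<not> ?thesis"
    then have "Suc k \<le> card A" by simp
    then obtain B where B: "B \<subseteq> A" "card B = Suc k" by (meson obtain_subset_with_card_n)
    obtain a where "a \<in> B" "card (star E a) < (k + 2)\<^sup>2 + k"
      using few_big_stars[OF finE E2 free B(2)] by blast
    moreover have "(k + 2)\<^sup>2 + k \<le> ?L"
      by (simp add: attract_bound_def power2_eq_square algebra_simps)
    ultimately show False using B(1) unfolding A_def by fastforce
  qed
  moreover have "\<not> card A \<le> k - 1"
  proof
    assume small: "card A \<le> k - 1"
    have star_le: "card (star E v) \<le> n" for v
    proof -
      have "star E v \<subseteq> (\<lambda>x. {v, x}) ` V"
        using E(1) by (auto simp: star_def pairs_def card_2_iff insert_commute)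
      then show ?thesis using V surj_card_le by blast
    qed
    have "\<not> free_matching f R (Suc k) M" for M
      using free[of M] by (auto simp: free_matching_def R_def)
    moreover have "card (star R v) \<le> ?L" for v
    proof (cases "v \<in> V - A")
      case True
      then have "card (star E v) \<le> ?L" by (auto simp: A_def)
      moreover have "star R v \<subseteq> star E v" by (auto simp: star_def R_def)
      ultimately show ?thesis using card_mono[of "star E v" "star R v"] finE by simp
    next
      case False
      then have "star R v = {}" using E(1) by (auto simp: star_def R_def pairs_def)
      then show ?thesis by simp
    qed
    ultimately have R: "card R \<le> 6 * Suc k * ?L"
      using finE E2 by (intro card_bounded_degree) (auto simp: R_def)
    have "E \<subseteq> (\<Union>a\<in>A. star E a) \<union> R" by (auto simp: star_def R_def)
    then have "card E \<le> card ((\<Union>a\<in>A. star E a) \<union> R)"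
      using finA finE by (intro card_mono) (auto simp: R_def)
    also have "\<dots> \<le> card (\<Union>a\<in>A. star E a) + card R" by (rule card_Un_le)
    also have "card (\<Union>a\<in>A. star E a) \<le> (\<Sum>a\<in>A. card (star E a))" using finA by (rule card_UN_le)
    also have "\<dots> \<le> card A * n" using star_le sum_bounded_above[of A "\<lambda>a. card (star E a)" n] by simp
    also have "\<dots> \<le> (k - 1) * n" using small by simp
    finally have "card E \<le> (k - 1) * n + 6 * Suc k * ?L" using R by simp
    moreover have "(k - 1) * n + n = k * n" using k by (cases k) auto
    \<comment> \<open>Subtraction is truncated, so \<open>k \<le> n\<close> is secured first; it
      follows from the summand \<open>k\<^sup>2\<close> of \<open>order_bound k\<close>.\<close>
    moreover have "k * (n - k) + k\<^sup>2 = k * n"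
    proof -
      have "k \<le> k\<^sup>2" using k by (simp add: power2_eq_square)
      then have "k \<le> n" using n by (simp add: order_bound_def)
      then show ?thesis by (metis add_mult_distrib2 le_add_diff_inverse2 power2_eq_square)
    qed
    moreover have "6 * Suc k * ?L + k\<^sup>2 \<le> n" using n by (simp add: order_bound_def algebra_simps)
    ultimately show False using dense by linarith
  qed
  ultimately have "card A = k" using k by linarith
  moreover have "A \<subseteq> V" by (auto simp: A_def)
  moreover have "?L \<le> card (star E a)" if "a \<in> A" for a using that by (simp add: A_def)
  moreover have "\<exists>a\<in>A. card {e \<in> star E a. f e \<noteq> r} < attract_bound k"
    if "r \<in> E" "r \<inter> A = {}" for r
    unfolding attract_bound_def
    using outer_edge_attracts_star[OF finE E2 free finA \<open>card A = k\<close> that] .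
  ultimately show thesis by (intro that)
qed

lemma card_split_le:
  assumes "finite V" "card V = n" "E \<subseteq> pairs V" "A \<subseteq> V" "card A = k"
  shows "card E \<le> (k choose 2) + k * (n - k) + card {r \<in> E. r \<inter> A = {}}"
proof -
  have "card E = card ({e \<in> E. e \<inter> A \<noteq> {}} \<union> {r \<in> E. r \<inter> A = {}})"
    by (rule arg_cong[where f = card]) blast
  also have "\<dots> \<le> card {e \<in> E. e \<inter> A \<noteq> {}} + card {r \<in> E. r \<inter> A = {}}"
    by (rule card_Un_le)
  finally have "card E \<le> card {e \<in> E. e \<inter> A \<noteq> {}} + card {r \<in> E. r \<inter> A = {}}" .
  moreover have "card {e \<in> E. e \<inter> A \<noteq> {}} \<le> card {e \<in> pairs V. e \<inter> A \<noteq> {}}"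
    using assms finite_pairs by (intro card_mono) auto
  ultimately show ?thesis using card_pairs_meeting[OF assms(1,4,5,2)] by simp
qed

text \<open>Above the Turan value, \<open>dense_core\<close> assigns to each edge avoiding
  \<open>A\<close> a star nearly all of which is mapped to it. The assignment is injective into
  \<open>A\<close>, hence at most \<open>k\<close> edges avoid \<open>A\<close>.\<close>

lemma free_matching_upper:
  assumes V: "finite V" "card V = n" and E: "E \<subseteq> pairs V" "\<And>e. e \<in> E \<Longrightarrow> f e \<noteq> e"
    and free: "\<And>M. \<not> free_matching f E (Suc k) M"
    and k: "k \<ge> 1" and n: "n \<ge> order_bound k"
  shows "card E \<le> (k choose 2) + k * (n - k) + k"
proof (cases "(k choose 2) + k * (n - k) < card E")
  case True
  obtain A where A: "A \<subseteq> V" "card A = k"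
    and big: "\<And>a. a \<in> A \<Longrightarrow> 2 * attract_bound k \<le> card (star E a)"
    and attract: "\<And>r. r \<in> E \<Longrightarrow> r \<inter> A = {} \<Longrightarrow> \<exists>a\<in>A. card {e \<in> star E a. f e \<noteq> r} < attract_bound k"
    using dense_core[OF V E free k n True] by blast
  let ?R = "{r \<in> E. r \<inter> A = {}}"
  obtain g where g: "\<And>r. r \<in> ?R \<Longrightarrow> g r \<in> A \<and> card {e \<in> star E (g r). f e \<noteq> r} < attract_bound k"
  proof -
    have "\<forall>r\<in>?R. \<exists>a. a \<in> A \<and> card {e \<in> star E a. f e \<noteq> r} < attract_bound k"
      using attract by blast
    from bchoice[OF this] show thesis using that by blast
  qed
  have "inj_on g ?R"
  proof (rule inj_onI, rule ccontr)
    fix r s assume rs: "r \<in> ?R" "s \<in> ?R" "g r = g s" "r \<noteq> s"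
    \<comment> \<open>No edge is mapped to both \<open>r\<close> and \<open>s\<close>, so the two
      small sets of exceptions cover the whole star.\<close>
    have "card (star E (g r)) =
        card ({e \<in> star E (g r). f e \<noteq> r} \<union> {e \<in> star E (g r). f e \<noteq> s})"
      using rs(4) by (intro arg_cong[where f = card]) blast
    also have "\<dots> \<le> card {e \<in> star E (g r). f e \<noteq> r} + card {e \<in> star E (g r). f e \<noteq> s}"
      by (rule card_Un_le)
    also have "\<dots> < 2 * attract_bound k" using g[OF rs(1)] g[OF rs(2)] rs(3) by simp
    finally show False using big[of "g r"] g[OF rs(1)] by simp
  qed
  moreover have "g ` ?R \<subseteq> A" using g by blast
  moreover have "finite A" using A V finite_subset by blast
  ultimately have "card ?R \<le> k" using A(2) card_inj_on_le by blast
  then show ?thesis using card_split_le[OF V E(1) A] by simp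
qed simp

text \<open>For the constant map to \<open>{}\<close> every edge of a star is an exception for
  \<open>r\<close>, so an edge avoiding \<open>A\<close> would force a large star to be
  small.\<close>

lemma matching_upper:
  assumes V: "finite V" "card V = n" and E: "E \<subseteq> pairs V"
    and free: "\<And>M. \<not> free_matching (\<lambda>_. {}) E (Suc k) M"
    and k: "k \<ge> 1" and n: "n \<ge> order_bound k"
  shows "card E \<le> (k choose 2) + k * (n - k)"
proof (rule ccontr)
  assume "\<not> ?thesis"
  then have dense: "(k choose 2) + k * (n - k) < card E" by simp
  have ne: "{} \<noteq> e" if "e \<in> E" for e using E that by (auto simp: pairs_def)
  obtain A where A: "A \<subseteq> V" "card A = k"
    and big: "\<And>a. a \<in> A \<Longrightarrow> 2 * attract_bound k \<le> card (star E a)"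
    and attract: "\<And>r. r \<in> E \<Longrightarrow> r \<inter> A = {} \<Longrightarrow>
      \<exists>a\<in>A. card {e \<in> star E a. {} \<noteq> r} < attract_bound k"
    using dense_core[OF V E ne free k n dense] by blast
  have empty: "{r \<in> E. r \<inter> A = {}} = {}"
  proof (rule ccontr)
    assume "\<not> ?thesis"
    then obtain r where r: "r \<in> E" "r \<inter> A = {}" by blast
    obtain a where "a \<in> A" "card {e \<in> star E a. {} \<noteq> r} < attract_bound k"
      using attract[OF r] by blast
    moreover have "{e \<in> star E a. {} \<noteq> r} = star E a" using ne[OF r(1)] by simp
    ultimately show False using big[of a] by simp
  qed
  show False using card_split_le[OF V E A] dense unfolding empty by simp
qed

section \<open>Constructions attaining the bounds\<close>

text \<open>The minimum of a set meeting \<open>{..<k}\<close> lies below \<open>k\<close>, and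
  disjoint sets have different minima. This bounds the size of matchings in the
  constructions.\<close>

lemma inj_Min_matching:
  fixes M :: "nat set set"
  assumes "pairwise disjnt M" "\<And>e. e \<in> M \<Longrightarrow> finite e \<and> e \<inter> {..<k} \<noteq> {}"
  shows "inj_on Min M" "Min ` M \<subseteq> {..<k}"
proof -
  have "Min e \<in> e \<and> Min e < k" if "e \<in> M" for e
    using assms(2)[OF that] by (auto intro: Min_in order.strict_trans1[OF Min_le])
  note * = this
  show "Min ` M \<subseteq> {..<k}" using * by auto
  show "inj_on Min M"
  proof (rule inj_onI, rule ccontr)
    fix d e assume de: "d \<in> M" "e \<in> M" "Min d = Min e" "d \<noteq> e"
    have "Min d \<in> d" "Min d \<in> e" using *[OF de(1)] *[OF de(2)] unfolding de(3) by simp_all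
    then have "\<not> disjnt d e" unfolding disjnt_iff by blast
    then show False using pairwiseD[OF assms(1) de(1,2,4)] by simp
  qed
qed

lemma matching_extremal:
  assumes "k \<le> n"
  defines "E \<equiv> {e \<in> pairs {..<n}. e \<inter> {..<k} \<noteq> {}}"
  shows "card E = (k choose 2) + k * (n - k)" "\<not> free_matching f E (Suc k) M"
proof -
  show "card E = (k choose 2) + k * (n - k)"
    unfolding E_def using assms(1) by (intro card_pairs_meeting) auto
  show "\<not> free_matching f E (Suc k) M"
  proof
    assume M: "free_matching f E (Suc k) M"
    then have "finite e \<and> e \<inter> {..<k} \<noteq> {}" if "e \<in> M" for e
      using that by (auto simp: free_matching_def E_def pairs_def intro: finite_subset)
    then have "card M \<le> card {..<k}"
      using M inj_Min_matching[of M k] card_inj_on_le[of Min M "{..<k}"]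
      by (simp add: free_matching_def)
    then show False using M by (simp add: free_matching_def)
  qed
qed

lemma free_matching_extremal:
  assumes k: "k \<ge> 1" and n: "n \<ge> 2 * k + 1"
  obtains E f where "E \<subseteq> pairs {..<n}" "card E = (k choose 2) + k * (n - k) + k"
    "\<And>e. e \<in> E \<Longrightarrow> f e \<in> E \<and> f e \<noteq> e" "\<And>M. \<not> free_matching f E (Suc k) M"
proof -
  define E0 where "E0 = {e \<in> pairs {..<n}. e \<inter> {..<k} \<noteq> {}}"
  \<comment> \<open>The extra edges form a star at \<open>k\<close>; a matching contains at most one of them, and it is the
    image of all edges with some minimum \<open>i < k\<close>.\<close>
  define x where "x i = {k, k + 1 + i}" for i
  define X where "X = x ` {..<k}"
  \<comment> \<open>Edges of \<open>X\<close> only need some value in the graph other than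
    themselves; \<open>{0, 1}\<close> is an edge of \<open>E0\<close> because
    \<open>k \<ge> 1\<close>.\<close>
  define f where "f e = (if Min e < k then x (Min e) else {0, 1})" for e :: "nat set"
  \<comment> \<open>The largest vertex used is \<open>2 * k\<close>, in \<open>x (k - 1)\<close>;
    here \<open>n \<ge> 2 * k + 1\<close> enters.\<close>
  have X: "X \<subseteq> pairs {..<n}" "\<And>e. e \<in> X \<Longrightarrow> k \<in> e \<and> Min e = k \<and> e \<inter> {..<k} = {}"
    using n by (auto simp: X_def x_def pairs_def card_insert_if)
  have Min: "Min e < k" "finite e" if "e \<in> E0" for e
  proof -
    show "finite e" using that by (auto simp: E0_def pairs_def intro: finite_subset)
    then show "Min e < k" using that by (auto simp: E0_def intro: order.strict_trans1[OF Min_le])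
  qed
  have "inj_on x {..<k}" by (auto simp: inj_on_def x_def doubleton_eq_iff)
  then have "card X = k" by (simp add: X_def card_image)
  moreover have "card E0 = (k choose 2) + k * (n - k)"
    unfolding E0_def using n by (intro matching_extremal) simp
  moreover have disj: "E0 \<inter> X = {}" using X(2) by (auto simp: E0_def)
  moreover have "finite E0" "finite X" by (simp_all add: E0_def X_def finite_pairs)
  ultimately have card: "card (E0 \<union> X) = (k choose 2) + k * (n - k) + k"
    by (simp add: card_Un_disjoint)
  have "f e \<in> E0 \<union> X \<and> f e \<noteq> e" if "e \<in> E0 \<union> X" for e
  proof (cases "e \<in> E0")
    case True
    then have "f e \<in> X" using Min by (auto simp: f_def X_def)
    then show ?thesis using True disj by auto
  next
    case False
    then have "f e = {0, 1}" using that X(2)[of e] by (simp add: f_def)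
    moreover have "{0, 1} \<in> E0" using k n by (auto simp: E0_def pairs_def)
    ultimately show ?thesis using False by auto
  qed
  moreover have "\<not> free_matching f (E0 \<union> X) (Suc k) M" for M
  proof
    assume "free_matching f (E0 \<union> X) (Suc k) M"
    then have M: "M \<subseteq> E0 \<union> X" "card M = Suc k" "pairwise disjnt M" "\<And>e. e \<in> M \<Longrightarrow> f e \<notin> M"
      by (auto simp: free_matching_def)
    have finM: "finite M" using M(2) by (metis card.infinite nat.distinct(1))
    have "pairwise disjnt (M \<inter> E0)" using M(3) by (rule pairwise_subset) simp
    moreover have "finite e \<and> e \<inter> {..<k} \<noteq> {}" if "e \<in> M \<inter> E0" for e
      using that Min by (auto simp: E0_def)
    ultimately have inj: "inj_on Min (M \<inter> E0)" and img: "Min ` (M \<inter> E0) \<subseteq> {..<k}"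
      using inj_Min_matching by blast+
    have XX: "d = e" if "d \<in> M \<inter> X" "e \<in> M \<inter> X" for d e
      using that X(2)[of d] X(2)[of e] M(3) by (auto simp: pairwise_def disjnt_iff)
    have "card (M \<inter> X) \<le> 1" using XX finM by (auto simp: card_le_Suc0_iff_eq)
    moreover have "card (M \<inter> E0) \<le> k" using card_inj_on_le[OF inj img] by simp
    moreover have "card M = card (M \<inter> E0) + card (M \<inter> X)"
    proof -
      have "M = (M \<inter> E0) \<union> (M \<inter> X)" using M(1) by blast
      moreover have "(M \<inter> E0) \<inter> (M \<inter> X) = {}" using disj by blast
      ultimately show ?thesis using finM by (metis card_Un_disjoint finite_Int)
    qed
    ultimately have c: "card (M \<inter> E0) = k" "card (M \<inter> X) = 1" using M(2) by linarith+
    \<comment> \<open>All \<open>k\<close> possible minima occur, so the edge \<open>x i\<close> in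
      \<open>M\<close> is the image of the edge of \<open>M\<close> with minimum
      \<open>i\<close>.\<close>
    have "Min ` (M \<inter> E0) = {..<k}"
      using img c(1) card_image[OF inj] by (intro card_subset_eq) auto
    moreover obtain d where "d \<in> M" "d \<in> X" using c(2) by (metis IntE card.empty ex_in_conv zero_neq_one)
    then obtain i where i: "i < k" "x i \<in> M" by (auto simp: X_def)
    ultimately obtain e where "e \<in> M" "Min e = i" by (metis IntE imageE lessThan_iff)
    then show False using M(4)[of e] i by (simp add: f_def)
  qed
  moreover have "E0 \<union> X \<subseteq> pairs {..<n}" using X(1) by (auto simp: E0_def)
  ultimately show thesis using card that by blast
qed

lemma large_order:
  assumes k: "k \<ge> 1" and n: "n \<ge> order_bound k + 2 * k + 1"
  shows "h n (matching_graph (Suc k)) = (k choose 2) + k * (n - k) + k"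
    "ex n (matching_graph (Suc k)) = (k choose 2) + k * (n - k)"
proof -
  have n': "n \<ge> 2 * k + 1" "n \<ge> order_bound k" "k \<le> n" using n by simp_all
  obtain E f where E: "E \<subseteq> pairs {..<n}" "card E = (k choose 2) + k * (n - k) + k"
    "\<And>e. e \<in> E \<Longrightarrow> f e \<in> E \<and> f e \<noteq> e" "\<And>M. \<not> free_matching f E (Suc k) M"
    using free_matching_extremal[OF k n'(1)] by blast
  show "h n (matching_graph (Suc k)) = (k choose 2) + k * (n - k) + k"
  proof (rule h_matching_eqI[OF _ _ E])
    fix V :: "nat set" and E f
    assume *: "finite V" "card V = n" "E \<subseteq> pairs V" "\<And>e. e \<in> E \<Longrightarrow> f e \<in> E \<and> f e \<noteq> e"
      and free: "\<And>M. \<not> free_matching f E (Suc k) M"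
    show "card E \<le> (k choose 2) + k * (n - k) + k"
      by (rule free_matching_upper[OF *(1-3) _ free k n'(2)]) (use *(4) in blast)
  qed simp_all
  show "ex n (matching_graph (Suc k)) = (k choose 2) + k * (n - k)"
  proof (rule ex_matching_eqI[where V = "{..<n}"])
    let ?E = "{e \<in> pairs {..<n}. e \<inter> {..<k} \<noteq> {}}"
    show "card ?E = (k choose 2) + k * (n - k)" "\<not> free_matching (\<lambda>_. {}) ?E (Suc k) M" for M
      using n'(3) by (rule matching_extremal)+
    show "?E \<subseteq> pairs {..<n}" by blast
    fix V :: "nat set" and E
    assume *: "finite V" "card V = n" "E \<subseteq> pairs V"
      and free: "\<And>M. \<not> free_matching (\<lambda>_. {}) E (Suc k) M"
    show "card E \<le> (k choose 2) + k * (n - k)"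
      by (rule matching_upper[OF * free k n'(2)])
  qed simp_all
qed

section \<open>Matchings with two edges\<close>

text \<open>The pairwise form of having no free matching with two edges, suited to counting disjoint
  pairs.\<close>

definition linked :: "('a set \<Rightarrow> 'a set) \<Rightarrow> 'a set set \<Rightarrow> bool" where
  "linked f E \<longleftrightarrow> (\<forall>e\<in>E. \<forall>d\<in>E. disjnt e d \<longrightarrow> f e = d \<or> f d = e)"

lemma linked_imp_no_free_matching:
  assumes "linked f E"
  shows "\<not> free_matching f E 2 M"
proof
  assume M: "free_matching f E 2 M"
  then obtain e d where ed: "M = {e, d}" "e \<noteq> d" by (auto simp: free_matching_def card_2_iff)
  then have "disjnt e d" "e \<in> E" "d \<in> E" "f e \<notin> M" "f d \<notin> M"
    using M by (auto simp: free_matching_def pairwise_insert)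
  then show False using assms ed(1) by (auto simp: linked_def)
qed

lemma no_free_matching_imp_linked:
  assumes "E \<subseteq> pairs V" "\<And>e. e \<in> E \<Longrightarrow> f e \<noteq> e" "\<And>M. \<not> free_matching f E 2 M"
  shows "linked f E"
  unfolding linked_def
proof (intro ballI impI, rule ccontr)
  fix e d assume ed: "e \<in> E" "d \<in> E" "disjnt e d" and no: "\<not> (f e = d \<or> f d = e)"
  have "e \<noteq> d" using ed assms(1) by (auto simp: pairs_def disjnt_def)
  then have "free_matching f E 2 {e, d}"
    using ed no assms(2)[OF ed(1)] assms(2)[OF ed(2)]
    by (auto simp: free_matching_def pairwise_insert disjnt_sym)
  then show False using assms(3) by blast
qed

definition disjoint_pairs :: "'a set set \<Rightarrow> 'a set set \<Rightarrow> ('a set \<times> 'a set) set" where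
  "disjoint_pairs S R = {(s, r) \<in> S \<times> R. disjnt s r}"

text \<open>Every disjoint pair has the form \<open>(s, f s)\<close> or \<open>(f r, r)\<close>, so
  each element of \<open>S\<close> or \<open>R\<close> accounts for at most one pair.\<close>

lemma card_disjoint_pairs_le:
  assumes "linked f E" "finite E" "S \<subseteq> E" "R \<subseteq> E"
  shows "card (disjoint_pairs S R) \<le> card S + card R"
proof -
  have fin: "finite S" "finite R" using assms finite_subset by blast+
  have "disjoint_pairs S R \<subseteq> (\<lambda>s. (s, f s)) ` S \<union> (\<lambda>r. (f r, r)) ` R"
    using assms by (fastforce simp: disjoint_pairs_def linked_def)
  then have "card (disjoint_pairs S R) \<le> card ((\<lambda>s. (s, f s)) ` S \<union> (\<lambda>r. (f r, r)) ` R)"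
    using fin by (intro card_mono) auto
  also have "\<dots> \<le> card ((\<lambda>s. (s, f s)) ` S) + card ((\<lambda>r. (f r, r)) ` R)" by (rule card_Un_le)
  also have "\<dots> \<le> card S + card R" using fin by (intro add_mono card_image_le)
  finally show ?thesis .
qed

text \<open>Of two disjoint edges in \<open>R\<close>, one is mapped to the other. Its value lies
  outside \<open>S\<close>, so it accounts for no pair.\<close>

lemma card_disjoint_pairs_less:
  assumes E: "linked f E" "finite E" "S \<subseteq> E" "R \<subseteq> E" "S \<inter> R = {}"
    and pq: "p \<in> R" "q \<in> R" "disjnt p q"
  shows "card (disjoint_pairs S R) < card S + card R"
proof -
  have fin: "finite S" "finite R" using E finite_subset by blast+
  obtain r where r: "r \<in> R" "f r \<in> R"
    using E(1,4) pq unfolding linked_def by blast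
  have "disjoint_pairs S R \<subseteq> (\<lambda>s. (s, f s)) ` S \<union> (\<lambda>r. (f r, r)) ` (R - {r})"
  proof
    fix x assume "x \<in> disjoint_pairs S R"
    then obtain s q where x: "x = (s, q)" "s \<in> S" "q \<in> R" "disjnt s q"
      by (auto simp: disjoint_pairs_def)
    have "f q = s \<Longrightarrow> q \<noteq> r" using x(2) r(2) E(5) by blast
    moreover have "f s = q \<or> f q = s" using x E(1,3,4) unfolding linked_def by blast
    ultimately show "x \<in> (\<lambda>s. (s, f s)) ` S \<union> (\<lambda>r. (f r, r)) ` (R - {r})"
      using x by blast
  qed
  then have "card (disjoint_pairs S R) \<le> card ((\<lambda>s. (s, f s)) ` S \<union> (\<lambda>r. (f r, r)) ` (R - {r}))"
    using fin by (intro card_mono) auto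
  also have "\<dots> \<le> card ((\<lambda>s. (s, f s)) ` S) + card ((\<lambda>r. (f r, r)) ` (R - {r}))"
    by (rule card_Un_le)
  also have "\<dots> \<le> card S + card (R - {r})"
    using fin by (intro add_mono card_image_le) auto
  also have "\<dots> < card S + card R" using card_Diff1_less[OF fin(2) r(1)] by simp
  finally show ?thesis .
qed

lemma card_disjoint_pairs_ge:
  assumes "finite S" "finite R" "\<And>r. r \<in> R \<Longrightarrow> c \<le> card {s \<in> S. disjnt s r}"
  shows "card R * c \<le> card (disjoint_pairs S R)"
proof -
  have "card R * c \<le> (\<Sum>r\<in>R. card {s \<in> S. disjnt s r})"
    using sum_bounded_below[of R c "\<lambda>r. card {s \<in> S. disjnt s r}"] assms(3) by simp
  also have "\<dots> = card (SIGMA r:R. {s \<in> S. disjnt s r})"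
    using assms by (intro card_SigmaI[symmetric]) auto
  also have "\<dots> = card (prod.swap ` (SIGMA r:R. {s \<in> S. disjnt s r}))"
    by (rule card_image[symmetric]) simp
  also have "prod.swap ` (SIGMA r:R. {s \<in> S. disjnt s r}) = disjoint_pairs S R"
    by (force simp: disjoint_pairs_def)
  finally show ?thesis .
qed

text \<open>\<open>B\<close> collects the vertices where \<open>e\<close> can meet the star, each
  costing at most one edge. Usually \<open>B\<close> is \<open>e\<close> itself, but a smaller
  \<open>B\<close> improves the bound when an endpoint of \<open>e\<close> is on no edge of the
  star.\<close>

lemma card_disjoint_star_ge:
  assumes "E \<subseteq> pairs V" "finite E" "finite B" "v \<notin> B" "\<And>s. s \<in> star E v \<Longrightarrow> s \<inter> e \<subseteq> B"
  shows "card (star E v) - card B \<le> card {s \<in> star E v. disjnt s e}"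
proof -
  have "card {s \<in> star E v. s \<inter> B \<noteq> {}} \<le> card B"
    using assms by (intro card_star_meeting) (auto simp: pairs_def)
  then have "card (star E v) - card B \<le> card (star E v - {s \<in> star E v. s \<inter> B \<noteq> {}})"
    using assms(2) by (intro card_Diff_ge) simp_all
  also have "\<dots> \<le> card {s \<in> star E v. disjnt s e}"
    using assms(2,5) by (intro card_mono) (auto simp: disjnt_def)
  finally show ?thesis .
qed

text \<open>Pairwise intersecting edges form a star or lie in a triangle, and four edges do not fit
  into a triangle.\<close>

lemma intersecting_common_vertex:
  assumes E: "R \<subseteq> pairs V" and R: "4 \<le> card R"
    and int: "\<And>d e. d \<in> R \<Longrightarrow> e \<in> R \<Longrightarrow> \<not> disjnt d e"
  shows "\<exists>u. \<forall>e\<in>R. u \<in> e"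
proof (rule ccontr)
  assume none: "\<not> ?thesis"
  have sub: "\<not> R \<subseteq> {x, y, z}" for x y z
  proof
    assume *: "R \<subseteq> {x, y, z}"
    then have "card R \<le> card {x, y, z}" by (intro card_mono) auto
    also have "\<dots> \<le> 3" by (simp add: card_insert_if)
    finally show False using R by simp
  qed
  obtain p where p: "p \<in> R" using sub by blast
  obtain q where q: "q \<in> R" "q \<noteq> p" using sub[of p p p] by blast
  obtain a where a: "a \<in> p" "a \<in> q" using int[OF p q(1)] by (auto simp: disjnt_iff)
  obtain b where b: "p = {a, b}" "b \<noteq> a" using E p a(1) by (auto elim: pairs_with)
  obtain c where c: "q = {a, c}" "c \<noteq> a" using E q a(2) by (auto elim: pairs_with)
  obtain r where r: "r \<in> R" "a \<notin> r" using none by blast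
  have "b \<in> r" "c \<in> r" using int[OF r(1) p] int[OF r(1) q(1)] r b c by (auto simp: disjnt_iff)
  moreover have "b \<noteq> c" using b c q by auto
  moreover have "card r = 2" using E r(1) by (auto simp: pairs_def)
  ultimately have rbc: "r = {b, c}" by (auto simp: card_2_iff)
  \<comment> \<open>\<open>p\<close>, \<open>q\<close>, \<open>r\<close> are the sides of the
    triangle on \<open>a\<close>, \<open>b\<close>, \<open>c\<close>; an edge meeting all three
    sides contains two of these vertices.\<close>
  have "R \<subseteq> {p, q, r}"
  proof
    fix d assume d: "d \<in> R"
    have "a \<in> d \<or> b \<in> d" "a \<in> d \<or> c \<in> d" "b \<in> d \<or> c \<in> d"
      using int[OF d p] int[OF d q(1)] int[OF d r(1)] by (auto simp: disjnt_iff b c rbc)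
    moreover have "card d = 2" using E d by (auto simp: pairs_def)
    ultimately show "d \<in> {p, q, r}"
      using b c rbc \<open>b \<noteq> c\<close> by (auto simp: card_2_iff)
  qed
  with sub show False by blast
qed

text \<open>With more than \<open>n\<close> edges, at least two lie outside a maximum star
  \<open>S\<close>, so \<open>card R * (card S - 2) \<le> card S + card R\<close> with
  \<open>card R \<ge> 2\<close>. This excludes stars of size 5 or at least 7 directly; sizes 4 and 6
  leave tight cases, and size at most 3 is settled by counting disjoint pairs in all of
  \<open>E\<close>.\<close>

lemma linked_card_le:
  assumes V: "finite V" "card V = n" and E: "E \<subseteq> pairs V" and linked: "linked f E"
    and m: "8 \<le> card E"
  shows "card E \<le> n"
proof (rule ccontr)
  assume "\<not> ?thesis"
  then have mn: "n + 1 \<le> card E" by simp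
  have finE: "finite E" using E V(1) finite_pairs by (blast intro: finite_subset)
  obtain e0 where "e0 \<in> E" using m by fastforce
  then have "V \<noteq> {}" using E by (auto simp: pairs_def)
  then have "Max ((\<lambda>v. card (star E v)) ` V) \<in> (\<lambda>v. card (star E v)) ` V"
    using V(1) by (intro Max_in) auto
  then obtain v where v: "v \<in> V" "Max ((\<lambda>v. card (star E v)) ` V) = card (star E v)" by auto
  define S where "S = star E v"
  define R where "R = E - S"
  have max: "card (star E u) \<le> card S" for u
  proof (cases "u \<in> V")
    case True
    then show ?thesis using V(1) v(2)[symmetric] by (simp add: S_def)
  next
    case False
    then have "star E u = {}" using E by (auto simp: star_def pairs_def)
    then show ?thesis by simp
  qed
  have SE: "S \<subseteq> E" and RE: "R \<subseteq> E" and SR: "S \<inter> R = {}" by (auto simp: S_def R_def star_def)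
  have finS: "finite S" and finR: "finite R" using SE RE finE finite_subset by blast+
  have mSR: "card E = card S + card R"
    using SE finE finS card_mono[OF finE SE] by (simp add: R_def card_Diff_subset)
  have Simg: "S \<subseteq> (\<lambda>x. {v, x}) ` (V - {v})"
    using E by (auto simp: S_def star_def pairs_def card_2_iff insert_commute)
  have Vv: "card (V - {v}) = n - 1" using V v by simp
  have n1: "n \<ge> 1" using V v(1) by (metis One_nat_def Suc_leI card_gt_0_iff empty_iff)
  have "card S \<le> n - 1" using surj_card_le[OF _ Simg] V Vv by simp
  then have R2: "2 \<le> card R" using mSR mn n1 by linarith
  have vR: "v \<notin> e" if "e \<in> R" for e using that by (auto simp: R_def S_def star_def)
  have card2: "card e = 2" "finite e" if "e \<in> E" for e
    using E V(1) that by (auto simp: pairs_def intro: finite_subset)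
  have ge: "card S - 2 \<le> card {s \<in> S. disjnt s e}" if "e \<in> R" for e
    using card_disjoint_star_ge[OF E finE, of e v e] card2[of e] vR[OF that] that RE
    by (auto simp: S_def)
  have main: "card R * (card S - 2) \<le> card (disjoint_pairs S R)"
    using ge by (intro card_disjoint_pairs_ge finS finR)
  have upper: "card (disjoint_pairs S R) \<le> card S + card R"
    by (rule card_disjoint_pairs_le[OF linked finE SE RE])
  \<comment> \<open>When the lower bound reaches \<open>card S + card R\<close>, no pair can be
    lost, so \<open>R\<close> is pairwise intersecting.\<close>
  have int: "\<not> disjnt p q" if "p \<in> R" "q \<in> R" "card S + card R \<le> card R * (card S - 2)" for p q
    using card_disjoint_pairs_less[OF linked finE SE RE SR that(1,2)] that(3) main by linarith
  consider "card S \<le> 3" | "card S = 4" | "card S = 5" | "card S = 6" | "card S \<ge> 7" by linarith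
  then show False
  proof cases
    case 1
    \<comment> \<open>All degrees are at most 3, so an edge meets at most
      \<open>3 + 3 - 1 = 5\<close> edges, itself included. Counting ordered pairs then gives
      \<open>card E - 5 \<le> 2\<close>.\<close>
    have "card E - 5 \<le> card {d \<in> E. disjnt d e}" if e: "e \<in> E" for e
    proof -
      obtain x y where xy: "e = {x, y}" "x \<noteq> y" using card2(1)[OF e] by (auto simp: card_2_iff)
      have "card (star E x) + card (star E y) = card (star E x \<union> star E y) + card (star E x \<inter> star E y)"
        using finE by (intro card_Un_Int) simp_all
      moreover have "e \<in> star E x \<inter> star E y" using e xy by (auto simp: star_def)
      then have "card (star E x \<inter> star E y) \<ge> 1"
        using finE by (metis One_nat_def Suc_leI card_gt_0_iff empty_iff finite_Int finite_star)
      ultimately have "card (star E x \<union> star E y) \<le> 5" using max[of x] max[of y] 1 by linarith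
      then have "card E - 5 \<le> card (E - (star E x \<union> star E y))"
        using finE by (intro card_Diff_ge) simp_all
      also have "E - (star E x \<union> star E y) = {d \<in> E. disjnt d e}"
        using xy by (auto simp: star_def disjnt_def)
      finally show ?thesis .
    qed
    then have "card E * (card E - 5) \<le> card (disjoint_pairs E E)"
      by (intro card_disjoint_pairs_ge finE)
    also have "\<dots> \<le> card E * 2"
      using card_disjoint_pairs_le[OF linked finE, of E E] by simp
    finally show False using m by auto
  next
    case 2
    \<comment> \<open>The inequality gives at most 4 edges in \<open>R\<close>, and having 8 edges
      forces equality.\<close>
    then have R4: "card R = 4" using main upper m mSR by simp
    then obtain u where u: "\<And>e. e \<in> R \<Longrightarrow> u \<in> e"
      using intersecting_common_vertex[OF subset_trans[OF RE E]] int 2 by auto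
    have "R \<subseteq> star E u" using u RE by (auto simp: star_def)
    \<comment> \<open>By maximality of \<open>S\<close>, \<open>R\<close> is the full star at
      \<open>u\<close>, so edges of \<open>S\<close> avoid \<open>u\<close> and meet an edge of
      \<open>R\<close> only at its other end. The bound 2 improves to 3, and
      \<open>4 * 3 > 4 + 4\<close>.\<close>
    then have Ru: "R = star E u" using max[of u] 2 R4 finE by (intro card_seteq) auto
    have "3 \<le> card {s \<in> S. disjnt s e}" if e: "e \<in> R" for e
    proof -
      obtain b where b: "e = {u, b}" using E e RE u by (meson pairs_with subsetD)
      have "s \<inter> e \<subseteq> {b}" if "s \<in> star E v" for s
      proof -
        have "s \<notin> R" using that by (simp add: R_def S_def)
        then have "u \<notin> s" using that by (simp add: Ru star_def)
        then show ?thesis by (auto simp: b)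
      qed
      moreover have "v \<noteq> b" using vR[OF e] b by auto
      ultimately show ?thesis
        using card_disjoint_star_ge[OF E finE, of "{b}" v e] 2 by (simp add: S_def)
    qed
    then have "card R * 3 \<le> card (disjoint_pairs S R)"
      by (intro card_disjoint_pairs_ge finS finR)
    then show False using upper R4 2 by simp
  next
    case 3
    \<comment> \<open>Here \<open>card R \<le> 2\<close>, which leaves at most 7 edges.\<close>
    then show False using main upper m mSR by simp
  next
    case 4
    \<comment> \<open>Again the count is tight, with 8 edges in all. Then \<open>n = 7\<close>, so
      \<open>v\<close> is joined to every other vertex, in particular to the common vertex
      \<open>b\<close> of \<open>R\<close>.\<close>
    then have R2: "card R = 2" using main upper m mSR by simp
    then have n: "n = 7" using mSR mn 4 \<open>card S \<le> n - 1\<close> by simp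
    obtain p q where pq: "R = {p, q}" using R2 by (auto simp: card_2_iff)
    obtain b where b: "b \<in> p" "b \<in> q" using int[of p q] pq R2 4 by (auto simp: disjnt_iff)
    have bv: "b \<in> V" "b \<noteq> v" using b(1) pq RE E vR[of p] by (auto simp: pairs_def)
    have "card ((\<lambda>x. {v, x}) ` (V - {v})) \<le> 6"
      using card_image_le[of "V - {v}" "\<lambda>x. {v, x}"] V Vv n by simp
    then have "S = (\<lambda>x. {v, x}) ` (V - {v})"
      using Simg 4 V by (intro card_seteq) auto
    then have "{v, b} \<in> S" using bv by blast
    \<comment> \<open>The count is tight for \<open>S\<close>, but \<open>{v, b}\<close> meets both edges of \<open>R\<close> and can be dropped.\<close>
    define S' where "S' = S - {{v, b}}"
    have S': "card S' = 5" "finite S'" "S' \<subseteq> E"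
      using \<open>{v, b} \<in> S\<close> 4 finS SE by (auto simp: S'_def)
    have "4 \<le> card {s \<in> S'. disjnt s e}" if e: "e \<in> R" for e
    proof -
      have "{s \<in> S'. disjnt s e} = {s \<in> S. disjnt s e}"
        using e b pq by (auto simp: S'_def)
      then show ?thesis using ge[OF e] 4 by simp
    qed
    then have "card R * 4 \<le> card (disjoint_pairs S' R)"
      by (intro card_disjoint_pairs_ge S' finR)
    also have "\<dots> \<le> card S' + card R"
      by (rule card_disjoint_pairs_le[OF linked finE S'(3) RE])
    finally show False using R2 S' by simp
  next
    case 5
    \<comment> \<open>Offsets remove the truncated subtraction: \<open>(2 + r) * (5 + d)\<close>
      exceeds \<open>9 + d + r\<close>.\<close>
    obtain d where d: "card S = 7 + d" using 5 le_Suc_ex by blast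
    obtain r where r: "card R = 2 + r" using R2 le_Suc_ex by blast
    have "card R * (card S - 2) \<le> card S + card R" using main upper by simp
    then show False unfolding d r by (simp add: algebra_simps)
  qed
qed

section \<open>Values for two edges and the final statement\<close>

lemma h_two_eqI:
  assumes "E \<subseteq> pairs {..<n}" "card E = m" "\<And>e. e \<in> E \<Longrightarrow> f e \<in> E \<and> f e \<noteq> e" "linked f E"
    and upper: "\<And>V E f. \<lbrakk>finite (V :: nat set); card V = n; E \<subseteq> pairs V; linked f E\<rbrakk> \<Longrightarrow> card E \<le> m"
  shows "h n (matching_graph 2) = m"
proof (rule h_matching_eqI[OF _ _ assms(1-3) linked_imp_no_free_matching[OF assms(4)]])
  fix V :: "nat set" and E f
  assume *: "finite V" "card V = n" "E \<subseteq> pairs V" "\<And>e. e \<in> E \<Longrightarrow> f e \<in> E \<and> f e \<noteq> e"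
    and free: "\<And>M. \<not> free_matching f E 2 M"
  have "linked f E" by (rule no_free_matching_imp_linked[OF *(3) _ free]) (use *(4) in blast)
  with * show "card E \<le> m" using upper by blast
qed simp_all

text \<open>The construction with \<open>k = 1\<close> is a spanning star plus one edge. For the
  upper bound, a graph with fewer than 8 edges has at most \<open>7 \<le> n\<close> of them.\<close>

lemma h_two_large:
  assumes "n \<ge> 7"
  shows "h n (matching_graph 2) = n"
proof -
  obtain E f where E: "E \<subseteq> pairs {..<n}" "card E = (1 choose 2) + 1 * (n - 1) + 1"
    "\<And>e. e \<in> E \<Longrightarrow> f e \<in> E \<and> f e \<noteq> e" "\<And>M. \<not> free_matching f E (Suc 1) M"
    using free_matching_extremal[of 1 n] assms by auto
  have cE: "card E = n" using E(2) assms by (simp add: binomial_eq_0)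
  have free: "\<not> free_matching f E 2 M" for M using E(4)[of M] by (simp add: numeral_2_eq_2)
  have "linked f E"
    by (rule no_free_matching_imp_linked[OF E(1) _ free]) (use E(3) in blast)
  show ?thesis
  proof (rule h_two_eqI[OF E(1) cE E(3) \<open>linked f E\<close>])
    fix V :: "nat set" and E f
    assume "finite V" "card V = n" "E \<subseteq> pairs V" "linked f E"
    then show "card E \<le> n" using linked_card_le[of V n E f] assms by linarith
  qed
qed

text \<open>In the complete graph on four vertices the only edge disjoint from \<open>e\<close> is
  its complement.\<close>

lemma h_two_4: "h 4 (matching_graph 2) = 6"
proof (rule h_two_eqI[where E = "pairs {..<4}" and f = "\<lambda>e. {..<4} - e"])
  show "card (pairs {..<4::nat}) = 6" by (simp add: card_pairs choose_two)
  show "{..<4} - e \<in> pairs {..<4} \<and> {..<4} - e \<noteq> e" if "e \<in> pairs {..<4}" for e :: "nat set"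
  proof
    have "card ({..<4} - e) = 2" using that by (subst card_Diff_subset) (auto simp: pairs_def intro: finite_subset)
    then show "{..<4} - e \<in> pairs {..<4}" by (auto simp: pairs_def)
    have "e \<noteq> {}" using that by (auto simp: pairs_def)
    then show "{..<4} - e \<noteq> e" by blast
  qed
  show "linked (\<lambda>e. {..<4} - e) (pairs {..<4::nat})"
    unfolding linked_def
  proof (intro ballI impI disjI1)
    fix e d :: "nat set" assume ed: "e \<in> pairs {..<4}" "d \<in> pairs {..<4}" "disjnt e d"
    have "finite e" using ed(1) by (auto simp: pairs_def intro: finite_subset)
    then have "card ({..<4} - e) = 2" using ed(1) by (subst card_Diff_subset) (auto simp: pairs_def)
    moreover have "d \<subseteq> {..<4} - e" "card d = 2" using ed by (auto simp: pairs_def disjnt_def)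
    ultimately have "d = {..<4} - e" by (intro card_subset_eq) auto
    then show "{..<4} - e = d" ..
  qed
  fix V :: "nat set" and E f
  assume *: "finite V" "card V = 4" "E \<subseteq> pairs V"
  then have "card E \<le> card (pairs V)" by (intro card_mono finite_pairs)
  then show "card E \<le> 6" using * by (simp add: card_pairs choose_two)
qed simp

text \<open>\<open>E\<close> is the complete graph on five vertices minus the triangle on 2, 3, 4.
  Its disjoint pairs form a 6-cycle around which \<open>f\<close> moves one step;
  \<open>{0,1}\<close> meets every edge and gets the default value. Eight edges would exceed
  \<open>n \<le> 6\<close>, contradicting \<open>linked_card_le\<close>.\<close>

lemma h_two_5_6:
  assumes "n \<in> {5, 6}"
  shows "h n (matching_graph 2) = 7"
proof -
  define E :: "nat set set" where "E = {{0,1},{0,2},{0,3},{0,4},{1,2},{1,3},{1,4}}"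
  define f :: "nat set \<Rightarrow> nat set" where
    "f e = (if e = {0,2} then {1,3} else if e = {1,3} then {0,4} else if e = {0,4} then {1,2}
      else if e = {1,2} then {0,3} else if e = {0,3} then {1,4} else {0,2})" for e
  show ?thesis
  proof (rule h_two_eqI[where E = E and f = f])
    show "E \<subseteq> pairs {..<n}" using assms by (auto simp: E_def pairs_def)
    show "card E = 7" by (simp add: E_def card_insert_if doubleton_eq_iff)
    show "f e \<in> E \<and> f e \<noteq> e" if "e \<in> E" for e
      using that unfolding E_def f_def by (elim insertE) (simp_all add: doubleton_eq_iff)
    show "linked f E"
      unfolding linked_def E_def f_def by (simp add: doubleton_eq_iff disjnt_insert1)
    fix V :: "nat set" and E f
    assume "finite V" "card V = n" "E \<subseteq> pairs V" "linked f E"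
    then show "card E \<le> 7" using linked_card_le[of V n E f] assms by force
  qed
qed

theorem theorem1p1:
  "(\<forall>n\<ge>7. h n (matching_graph 2) = n) \<and>
   h 4 (matching_graph 2) = 6 \<and>
   h 5 (matching_graph 2) = 7 \<and>
   h 6 (matching_graph 2) = 7 \<and>
   (\<forall>t\<ge>3. \<exists>n\<^sub>t. \<forall>n\<ge>n\<^sub>t.
      h n (matching_graph t) = ex n (matching_graph t) + t - 1 \<and>
      ex n (matching_graph t) + t - 1
        = (t - 1) * (n - t + 1) + ((t - 1) choose 2) + (t - 1))"
proof (intro conjI)
  show "\<forall>t\<ge>3. \<exists>n\<^sub>t. \<forall>n\<ge>n\<^sub>t.
      h n (matching_graph t) = ex n (matching_graph t) + t - 1 \<and>
      ex n (matching_graph t) + t - 1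
        = (t - 1) * (n - t + 1) + ((t - 1) choose 2) + (t - 1)"
  proof (intro allI impI)
    fix t :: nat assume "t \<ge> 3"
    then obtain k where t: "t = Suc k" and k: "k \<ge> 1" by (cases t) auto
    show "\<exists>n\<^sub>t. \<forall>n\<ge>n\<^sub>t. h n (matching_graph t) = ex n (matching_graph t) + t - 1 \<and>
      ex n (matching_graph t) + t - 1 = (t - 1) * (n - t + 1) + ((t - 1) choose 2) + (t - 1)"
    proof (intro exI[of _ "order_bound k + 2 * k + 1"] allI impI)
      fix n assume n: "n \<ge> order_bound k + 2 * k + 1"
      \<comment> \<open>With truncated subtraction this needs \<open>t \<le> n\<close>, which the
        choice of the threshold provides.\<close>
      have "n - t + 1 = n - k" using n t by simp
      then show "h n (matching_graph t) = ex n (matching_graph t) + t - 1 \<and>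
        ex n (matching_graph t) + t - 1 = (t - 1) * (n - t + 1) + ((t - 1) choose 2) + (t - 1)"
        unfolding t by (simp add: large_order[OF k n])
    qed
  qed
qed (simp_all add: h_two_large h_two_4 h_two_5_6)

end
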